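(* Let $(k_n)_{n\ge 2}$ be any sequence of integers with $1\le k_n\le n-1$. Then \[\lim_{n\to\infty}\frac{Kf(Q_{n,k_n})}{\frac{2^{2n}}{n+1}}=1.\]
   Context: For $n\ge 2$ and $1\le k\le n-1$, the enhanced hypercube $Q_{n,k}$ is the simple graph whose vertices are the binary strings $x_1x_2\cdots x_n$ ($x_i\in\{0,1\}$), where $X=x_1\cdots x_n$ and $Y$ are adjacent iff either $Y$ is obtained from $X$ by complementing exactly one coordinate ($1\le i\le n$), or $Y=x_1\cdots x_{k-1}\overline{x_k}\,\overline{x_{k+1}}\cdots\overline{x_n}$. For a connected graph $\Gamma$, the resistance distance $r_{ij}$ between vertices $v_i,v_j$ is the effective resistance between them when every edge is a unit resistor, and the Kirchhoff index is $Kf(\Gamma)=\sum_{i<j} r_{ij}$. *)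

theory Defs
  imports Complex_Main "HOL-Library.List_Lexorder" "Graph_Theory.Digraph_Component"
begin

text \<open>
  Finite simple graphs are represented by \<^locale>\<open>pair_graph\<close>: an undirected edge is a pair of
  opposite arcs. Binary strings are \<^typ>\<open>bool list\<close>s. List positions are 0-based, so the
  coordinate $x_i$ is \<open>X ! (i - 1)\<close>, and dropping the first \<open>k - 1\<close> entries of \<open>X\<close> leaves
  $x_k \ldots x_n$.
\<close>

definition hypercube_adj :: "nat \<Rightarrow> nat \<Rightarrow> bool list \<Rightarrow> bool list \<Rightarrow> bool" where
  "hypercube_adj n k X Y \<longleftrightarrow>
     (\<exists>i\<in>{1..n}. Y = X[i - 1 := \<not> X ! (i - 1)]) \<or>
     Y = take (k - 1) X @ map Not (drop (k - 1) X)"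

definition enhanced_hypercube :: "nat \<Rightarrow> nat \<Rightarrow> bool list pair_pre_digraph" where
  "enhanced_hypercube n k =
     \<lparr> pverts = {X. length X = n},
       parcs = {(X, Y). length X = n \<and> length Y = n \<and> hypercube_adj n k X Y} \<rparr>"

text \<open>
  Unit resistors on the edges: by Ohm's law the current from \<open>u\<close> to a neighbour \<open>w\<close> is
  \<open>\<phi> u - \<phi> w\<close>. A unit current enters the network at \<open>s\<close> and leaves it at \<open>t\<close>, so Kirchhoff's
  current law prescribes the net current out of every vertex. In a connected graph such a
  potential exists and is unique up to an additive constant, so its drop from \<open>s\<close> to \<open>t\<close>
  is well defined.
\<close>

definition unit_current_potential ::
    "'a pair_pre_digraph \<Rightarrow> 'a \<Rightarrow> 'a \<Rightarrow> ('a \<Rightarrow> real) \<Rightarrow> bool" where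
  "unit_current_potential G s t \<phi> \<longleftrightarrow>
     (\<forall>u\<in>pverts G. (\<Sum>w | (u, w) \<in> parcs G. \<phi> u - \<phi> w) = of_bool (u = s) - of_bool (u = t))"

definition resistance_distance :: "'a pair_pre_digraph \<Rightarrow> 'a \<Rightarrow> 'a \<Rightarrow> real" where
  "resistance_distance G s t = (THE r. \<exists>\<phi>. unit_current_potential G s t \<phi> \<and> r = \<phi> s - \<phi> t)"

text \<open>
  The linear order (lexicographic on \<^typ>\<open>bool list\<close>) serves only to count each unordered pair
  of vertices once.
\<close>

definition kirchhoff_index :: "'a::linorder pair_pre_digraph \<Rightarrow> real" where
  "kirchhoff_index G =
     (\<Sum>(u, v) | u \<in> pverts G \<and> v \<in> pverts G \<and> u < v. resistance_distance G u v)"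

lemma hypercube_adj_sym:
  assumes "length X = n" "hypercube_adj n k X Y"
  shows "hypercube_adj n k Y X"
  using assms(2) unfolding hypercube_adj_def
proof (elim disjE bexE)
  fix i assume i: "i \<in> {1..n}" and Y: "Y = X[i - 1 := \<not> X ! (i - 1)]"
  have less: "i - 1 < length X"
    using i assms(1) by auto
  have "X = Y[i - 1 := \<not> Y ! (i - 1)]"
    using less unfolding Y by simp
  then show "(\<exists>i\<in>{1..n}. X = Y[i - 1 := \<not> Y ! (i - 1)]) \<or>
      X = take (k - 1) Y @ map Not (drop (k - 1) Y)"
    using i by blast
next
  assume Y: "Y = take (k - 1) X @ map Not (drop (k - 1) X)"
  have "X = take (k - 1) Y @ map Not (drop (k - 1) Y)"
    unfolding Y by (cases "k - 1 \<le> length X") (simp_all add: comp_def)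
  then show "(\<exists>i\<in>{1..n}. X = Y[i - 1 := \<not> Y ! (i - 1)]) \<or>
      X = take (k - 1) Y @ map Not (drop (k - 1) Y)" ..
qed

lemma hypercube_adj_irrefl:
  assumes "length X = n" "1 \<le> k" "k \<le> n"
  shows "\<not> hypercube_adj n k X X"
proof
  assume adj: "hypercube_adj n k X X"
  have "X[i - 1 := \<not> X ! (i - 1)] ! (i - 1) = (\<not> X ! (i - 1))" if "i \<in> {1..n}" for i
  proof -
    have "i - 1 < length X"
      using that assms(1) by auto
    then show ?thesis by simp
  qed
  then have 1: "X \<noteq> X[i - 1 := \<not> X ! (i - 1)]" if "i \<in> {1..n}" for i
    using that by metis
  have "(take (k - 1) X @ map Not (drop (k - 1) X)) ! (k - 1) = (\<not> X ! (k - 1))"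
    using assms by (simp add: nth_append)
  then have "X \<noteq> take (k - 1) X @ map Not (drop (k - 1) X)"
    by metis
  with 1 adj show False
    unfolding hypercube_adj_def by blast
qed

lemma pair_graph_enhanced_hypercube:
  assumes "1 \<le> k" "k \<le> n"
  shows "pair_graph (enhanced_hypercube n k)"
proof -
  let ?V = "{X :: bool list. length X = n}"
  have V: "pverts (enhanced_hypercube n k) = ?V"
    and E: "parcs (enhanced_hypercube n k) = {(X, Y). X \<in> ?V \<and> Y \<in> ?V \<and> hypercube_adj n k X Y}"
    by (simp_all add: enhanced_hypercube_def)
  have fin: "finite ?V"
    using finite_lists_length_eq[of "UNIV :: bool set" n] by simp
  have "finite (parcs (enhanced_hypercube n k))"
    by (rule finite_subset[of _ "?V \<times> ?V"]) (auto simp only: E fin finite_cartesian_product)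
  moreover have "symmetric (with_proj (enhanced_hypercube n k))"
    unfolding symmetric_def with_proj_simps E by (auto intro!: symI hypercube_adj_sym)
  moreover have "fst e \<noteq> snd e" if "e \<in> parcs (enhanced_hypercube n k)" for e
    using that hypercube_adj_irrefl[OF _ assms] by (cases e)
      (auto simp only: E fst_conv snd_conv mem_Collect_eq case_prod_conv)
  moreover have "fst e \<in> ?V \<and> snd e \<in> ?V" if "e \<in> parcs (enhanced_hypercube n k)" for e
    using that by (cases e) (simp add: E)
  ultimately show ?thesis
    using fin by unfold_locales (simp_all only: V not_False_eq_True)
qed

end

theory Submission
  imports Defs "HOL-Real_Asymp.Real_Asymp"
begin

text \<open>
  The graph is a Cayley graph of the group of binary strings, so the Walsh characters
  $\chi_S$, for \<open>S\<close> a set of positions, diagonalise its Laplacian, with eigenvalues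
  $\lambda_S = 2|S| + 1 - (-1)^{m}$ where \<open>m\<close> counts the positions of \<open>S\<close> that the additional
  edges complement. Expanding the potential in characters gives
  $Kf = 2^n \sum_{S \neq \emptyset} 1/\lambda_S$. Since $2|S| \le \lambda_S \le 2|S| + 2$, the sum
  is squeezed between sums of the form $\sum_j \binom{n}{j}/(j+1)$ and
  $\sum_j \binom{n}{j}/((j+1)(j+2))$, which are evaluated by absorption.
\<close>

section \<open>Effective resistance\<close>

text \<open>
  The Laplacian is symmetric. Pairing two potentials for the same poles with each other's
  Laplacian therefore shows that their drops agree, without any use of connectivity.
\<close>

lemma laplacian_symmetric:
  fixes \<phi> \<psi> :: "'a \<Rightarrow> real"
  assumes "pair_graph G"
  shows "(\<Sum>u\<in>pverts G. \<psi> u * (\<Sum>w | (u, w) \<in> parcs G. \<phi> u - \<phi> w)) =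
         (\<Sum>u\<in>pverts G. \<phi> u * (\<Sum>w | (u, w) \<in> parcs G. \<psi> u - \<psi> w))"
proof -
  interpret pair_graph G by fact
  let ?N = "\<lambda>u. {w. (u, w) \<in> parcs G}"
  have N: "?N u \<subseteq> pverts G" for u
    using arc_snd_in_verts by fastforce
  have fin: "finite (pverts G)"
    by (rule pair_finite_verts)
  have sum_N: "(\<Sum>w\<in>?N u. f w) = (\<Sum>w\<in>pverts G. if (u, w) \<in> parcs G then f w else 0)"
    for u and f :: "'a \<Rightarrow> real"
    using N[of u] fin by (subst sum.inter_filter[symmetric]) (auto intro!: sum.cong)
  have sym: "(u, w) \<in> parcs G \<longleftrightarrow> (w, u) \<in> parcs G" for u w
    using arcs_symmetric by blast
  have cross: "(\<Sum>u\<in>pverts G. \<Sum>w\<in>?N u. f u * g w) = (\<Sum>u\<in>pverts G. \<Sum>w\<in>?N u. g u * f w)"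
    for f g :: "'a \<Rightarrow> real"
    unfolding sum_N by (subst sum.swap, intro sum.cong refl) (use sym in auto)
  show ?thesis
    using cross[of \<psi> \<phi>]
    by (simp add: sum_distrib_left right_diff_distrib sum_subtractf mult.commute mult.left_commute)
qed

lemma resistance_distance_eqI:
  assumes "pair_graph G" "s \<in> pverts G" "t \<in> pverts G" "unit_current_potential G s t \<phi>"
  shows "resistance_distance G s t = \<phi> s - \<phi> t"
proof -
  interpret pair_graph G by fact
  have fin: "finite (pverts G)"
    by (rule pair_finite_verts)
  \<comment> \<open>Pairing any \<open>f\<close> with the net currents of \<open>g\<close> picks out
    the values of \<open>f\<close> at the poles. Applied to two potentials in both orders, this
    makes their drops equal; for \<open>s = t\<close> both sides vanish.\<close>
  have drop: "(\<Sum>u\<in>pverts G. f u * (\<Sum>w | (u, w) \<in> parcs G. g u - g w)) = f s - f t"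
    if "unit_current_potential G s t g" for f g :: "'a \<Rightarrow> real"
  proof -
    have "(\<Sum>u\<in>pverts G. f u * (\<Sum>w | (u, w) \<in> parcs G. g u - g w)) =
        (\<Sum>u\<in>pverts G. (if u = s then f u else 0) - (if u = t then f u else 0))"
      using that unfolding unit_current_potential_def by (intro sum.cong) auto
    also have "\<dots> = f s - f t"
      using assms fin by (simp add: sum_subtractf)
    finally show ?thesis .
  qed
  have "\<psi> s - \<psi> t = \<phi> s - \<phi> t" if "unit_current_potential G s t \<psi>" for \<psi>
    using drop[OF that, of \<phi>] drop[OF assms(4), of \<psi>] laplacian_symmetric[OF assms(1)]
    by metis
  then show ?thesis
    unfolding resistance_distance_def using assms(4) by blast
qed

text \<open>Passing to ordered pairs removes the linear order, so that sums over the two endpoints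
  can be factored.\<close>

lemma sum_less_pairs:
  fixes r :: "'a::linorder \<Rightarrow> 'a \<Rightarrow> real"
  assumes "finite V" and sym: "\<And>u v. r u v = r v u" and diag: "\<And>u. r u u = 0"
  shows "(\<Sum>(u, v) | u \<in> V \<and> v \<in> V \<and> u < v. r u v) = (\<Sum>u\<in>V. \<Sum>v\<in>V. r u v) / 2"
proof -
  let ?L = "{(u, v). u \<in> V \<and> v \<in> V \<and> u < v}"
  let ?G = "{(u, v). u \<in> V \<and> v \<in> V \<and> v < u}"
  let ?D = "{(u, v). u \<in> V \<and> v \<in> V \<and> u = v}"
  have fin: "finite ?L" "finite ?G" "finite ?D"
    by (rule finite_subset[of _ "V \<times> V"]; use assms(1) in auto)+
  have "V \<times> V = (?L \<union> ?G) \<union> ?D"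
    by auto
  then have "(\<Sum>u\<in>V. \<Sum>v\<in>V. r u v) = (\<Sum>(u, v)\<in>(?L \<union> ?G) \<union> ?D. r u v)"
    by (simp only: sum.cartesian_product)
  also have "\<dots> = (\<Sum>(u, v)\<in>?L. r u v) + (\<Sum>(u, v)\<in>?G. r u v) + (\<Sum>(u, v)\<in>?D. r u v)"
    using fin by (subst sum.union_disjoint; (subst sum.union_disjoint)?) auto
  also have "(\<Sum>(u, v)\<in>?D. r u v) = 0"
    by (intro sum.neutral) (auto simp: diag)
  also have "(\<Sum>(u, v)\<in>?G. r u v) = (\<Sum>(u, v)\<in>?L. r u v)"
    by (rule sum.reindex_bij_witness[of _ "\<lambda>(u, v). (v, u)" "\<lambda>(u, v). (v, u)"])
      (auto simp: sym)
  finally show ?thesis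
    by simp
qed

section \<open>Walsh characters\<close>

text \<open>The characters of the group of binary strings under addition modulo 2, indexed by the
  positions they read.\<close>

definition walsh :: "nat set \<Rightarrow> bool list \<Rightarrow> real" where
  "walsh S X = (\<Prod>i\<in>S. if X ! i then -1 else 1)"

lemma walsh_empty [simp]: "walsh {} X = 1"
  by (simp add: walsh_def)

lemma walsh_square: "walsh S X * walsh S X = 1"
  unfolding walsh_def by (subst prod.distrib[symmetric]) (rule prod.neutral, auto)

lemma walsh_orthogonal:
  assumes "length X = n" "length Y = n"
  shows "(\<Sum>S\<in>Pow {..<n}. walsh S X * walsh S Y) = 2 ^ n * of_bool (X = Y)"
proof -
  let ?f = "\<lambda>i. (if X ! i then -1 else 1) * (if Y ! i then -1 else 1 :: real)"
  have "(\<Sum>S\<in>Pow {..<n}. walsh S X * walsh S Y) = (\<Sum>S\<in>Pow {..<n}. \<Prod>i\<in>S. ?f i)"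
    by (simp add: walsh_def prod.distrib)
  \<comment> \<open>The sum over all \<open>S\<close> is the expansion of this product. A factor is
    2 where the strings agree and 0 where they differ.\<close>
  also have "\<dots> = (\<Prod>i<n. ?f i + 1)"
    by (subst prod_add) simp_all
  also have "\<dots> = 2 ^ n * of_bool (X = Y)"
  proof (cases "X = Y")
    case True
    then have "(\<Prod>i<n. ?f i + 1) = (\<Prod>i<n. 2)"
      by (intro prod.cong) auto
    with True show ?thesis
      by simp
  next
    case False
    then obtain i where "i < n" "X ! i \<noteq> Y ! i"
      using assms by (auto simp: list_eq_iff_nth_eq)
    then have "(\<Prod>i<n. ?f i + 1) = 0"
      by (intro prod_zero) (auto intro!: bexI[of _ i])
    with False show ?thesis
      by simp
  qed
  finally show ?thesis .
qed

lemma walsh_flip: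
  assumes "length X = n" "S \<subseteq> {..<n}" "i < n"
  shows "walsh S (X[i := \<not> X ! i]) = (if i \<in> S then -1 else 1) * walsh S X"
proof -
  have fin: "finite S"
    using assms(2) finite_subset by blast
  have "walsh S (X[i := \<not> X ! i]) =
      (\<Prod>j\<in>S. (if j = i then -1 else 1) * (if X ! j then -1 else 1))"
    unfolding walsh_def using assms by (intro prod.cong) (auto simp: nth_list_update)
  then show ?thesis
    using fin by (simp add: prod.distrib walsh_def)
qed

lemma walsh_complement_drop:
  assumes "length X = n" "S \<subseteq> {..<n}" "m \<le> n"
  shows "walsh S (take m X @ map Not (drop m X)) = (-1) ^ card (S \<inter> {m..<n}) * walsh S X"
proof -
  have fin: "finite S"
    using assms(2) finite_subset by blast
  have S: "S \<inter> {m..<n} = {j \<in> S. m \<le> j}"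
    using assms(2) by auto
  have "walsh S (take m X @ map Not (drop m X)) =
      (\<Prod>j\<in>S. (if m \<le> j then -1 else 1) * (if X ! j then -1 else 1))"
    unfolding walsh_def using assms by (intro prod.cong) (auto simp: nth_append)
  also have "\<dots> = (\<Prod>j\<in>S. if m \<le> j then -1 else 1) * walsh S X"
    by (simp add: prod.distrib walsh_def)
  also have "(\<Prod>j\<in>S. if m \<le> j then -1 else 1 :: real) = (-1) ^ card (S \<inter> {m..<n})"
    unfolding S using fin by (simp flip: prod.inter_filter)
  finally show ?thesis .
qed

text \<open>Flipping a coordinate in \<open>S\<close> permutes the strings and negates the
  character, so the sum equals its own negative.\<close>

lemma sum_walsh:
  assumes "S \<subseteq> {..<n}" "S \<noteq> {}"
  shows "(\<Sum>X | length X = n. walsh S X) = 0"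
proof -
  obtain i where i: "i \<in> S" "i < n"
    using assms by auto
  let ?flip = "\<lambda>X. X[i := \<not> X ! i]"
  have "(\<Sum>X | length X = n. walsh S X) = (\<Sum>X | length X = n. walsh S (?flip X))"
    using i by (intro sum.reindex_bij_witness[of _ ?flip ?flip]) auto
  also have "\<dots> = (\<Sum>X | length X = n. - walsh S X)"
    using i assms by (intro sum.cong) (auto simp: walsh_flip)
  finally show ?thesis
    by (simp add: sum_negf)
qed

section \<open>The Kirchhoff index of the enhanced hypercube\<close>

text \<open>A coordinate flip in \<open>S\<close> contributes 1 - (-1) = 2, any other flip 0. The
  bracket comes from the additional edge, which complements the positions \<open>{k - 1..<n}\<close>
  counted from 0.\<close>

definition laplacian_eigenvalue :: "nat \<Rightarrow> nat \<Rightarrow> nat set \<Rightarrow> real" where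
  "laplacian_eigenvalue n k S = 2 * real (card S) + (1 - (-1) ^ card (S \<inter> {k - 1..<n}))"

text \<open>By parity the bracket is 0 or 2. The bounds are independent of \<open>k\<close>, which
  is why every sequence gives the same limit.\<close>

lemma laplacian_eigenvalue_bounds:
  "2 * real (card S) \<le> laplacian_eigenvalue n k S"
  "laplacian_eigenvalue n k S \<le> 2 * (real (card S) + 1)"
  by (cases "even (card (S \<inter> {k - 1..<n}))"; simp add: laplacian_eigenvalue_def)+

text \<open>The bound \<open>k \<le> n - 1\<close> ensures that the additional edge at a vertex is not a cube edge.\<close>

lemma sum_neighbours:
  fixes f :: "bool list \<Rightarrow> real"
  assumes "1 \<le> k" "k < n" "length X = n"
  shows "(\<Sum>Y | (X, Y) \<in> parcs (enhanced_hypercube n k). f Y) =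
    (\<Sum>i<n. f (X[i := \<not> X ! i])) + f (take (k - 1) X @ map Not (drop (k - 1) X))"
proof -
  let ?flip = "\<lambda>i. X[i := \<not> X ! i]"
  define Z where "Z = take (k - 1) X @ map Not (drop (k - 1) X)"
  have Z_length: "length Z = n"
    using assms by (simp add: Z_def)
  have Z_nth: "Z ! j = (\<not> X ! j)" if "k - 1 \<le> j" "j < n" for j
    using that assms by (simp add: Z_def nth_append)
  have Z: "Z \<notin> ?flip ` {..<n}"
  proof
    assume "Z \<in> ?flip ` {..<n}"
    then obtain i where Z_eq: "Z = ?flip i"
      by blast
    \<comment> \<open>As \<open>k < n\<close>, the additional edge complements both positions
      \<open>k - 1\<close> and \<open>k\<close>; \<open>j\<close> is one of them other than
      \<open>i\<close>.\<close>
    define j where "j = (if i = k then k - 1 else k)"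
    have j: "k - 1 \<le> j" "j < n" "j \<noteq> i"
      using assms by (auto simp: j_def)
    then have "Z ! j = X ! j"
      by (simp add: Z_eq)
    with Z_nth[OF j(1,2)] show False
      by simp
  qed
  have inj: "inj_on ?flip {..<n}"
  proof (rule inj_onI)
    fix i j assume ij: "i \<in> {..<n}" "j \<in> {..<n}" "?flip i = ?flip j"
    have "?flip i ! i = (\<not> X ! i)"
      using ij(1) assms(3) by simp
    then have "?flip j ! i = (\<not> X ! i)"
      unfolding ij(3) .
    then show "i = j"
      by (cases "i = j") simp_all
  qed
  have "(\<lambda>i. i - 1) ` {1..n} = {..<n}"
    by (auto simp: image_iff intro!: bexI[of _ "Suc _"])
  then have shift: "(\<exists>i\<in>{1..n}. Y = ?flip (i - 1)) \<longleftrightarrow> Y \<in> ?flip ` {..<n}" for Y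
    by (metis (no_types, lifting) image_iff)
  have arcs: "(X, Y) \<in> parcs (enhanced_hypercube n k) \<longleftrightarrow>
      length Y = n \<and> (Y \<in> ?flip ` {..<n} \<or> Y = Z)" for Y
    unfolding shift[symmetric] using assms(3)
    by (simp add: enhanced_hypercube_def hypercube_adj_def Z_def)
  have "{Y. (X, Y) \<in> parcs (enhanced_hypercube n k)} = insert Z (?flip ` {..<n})"
    unfolding arcs using assms(3) Z_length by auto
  then show ?thesis
    using Z by (simp add: sum.reindex[OF inj] add.commute Z_def)
qed

lemma laplacian_walsh:
  assumes "1 \<le> k" "k < n" "length X = n" "S \<subseteq> {..<n}"
  shows "(\<Sum>Y | (X, Y) \<in> parcs (enhanced_hypercube n k). walsh S X - walsh S Y) =
    laplacian_eigenvalue n k S * walsh S X"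
proof -
  have S: "{i. i < n \<and> i \<in> S} = S"
    using assms by auto
  have "(\<Sum>i<n. walsh S X - walsh S (X[i := \<not> X ! i])) =
      (\<Sum>i<n. if i \<in> S then 2 * walsh S X else 0)"
    using assms by (intro sum.cong) (auto simp: walsh_flip)
  also have "\<dots> = 2 * card S * walsh S X"
    by (simp add: S flip: sum.inter_filter)
  finally show ?thesis
    using assms by (simp add: sum_neighbours walsh_complement_drop
        laplacian_eigenvalue_def algebra_simps)
qed

text \<open>The source \<open>of_bool (X = s) - of_bool (X = t)\<close> has Walsh coefficients
  \<open>(walsh S s - walsh S t) / 2 ^ n\<close>, and dividing them by the eigenvalues inverts the
  Laplacian. The empty set, of eigenvalue 0, is left out.\<close>

lemma unit_current_potential_walsh:
  assumes "1 \<le> k" "k < n" "length s = n" "length t = n"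
  shows "unit_current_potential (enhanced_hypercube n k) s t
    (\<lambda>X. (\<Sum>S\<in>Pow {..<n} - {{}}.
      (walsh S s - walsh S t) / laplacian_eigenvalue n k S * walsh S X) / 2 ^ n)"
  unfolding unit_current_potential_def
proof
  fix X assume "X \<in> pverts (enhanced_hypercube n k)"
  then have X: "length X = n"
    by (simp add: enhanced_hypercube_def)
  let ?P = "Pow {..<n} - {{}}"
  let ?ev = "laplacian_eigenvalue n k"
  let ?c = "\<lambda>S. (walsh S s - walsh S t) / ?ev S"
  let ?N = "{Y. (X, Y) \<in> parcs (enhanced_hypercube n k)}"
  have ev: "?ev S \<noteq> 0" if "S \<in> ?P" for S
  proof -
    have "card S > 0"
      using that by (auto simp: card_gt_0_iff intro: finite_subset)
    then show ?thesis
      using laplacian_eigenvalue_bounds(1)[of S n k] by simp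
  qed
  have "(\<Sum>Y\<in>?N. (\<Sum>S\<in>?P. ?c S * walsh S X) / 2 ^ n - (\<Sum>S\<in>?P. ?c S * walsh S Y) / 2 ^ n) =
      (\<Sum>Y\<in>?N. \<Sum>S\<in>?P. ?c S * (walsh S X - walsh S Y)) / 2 ^ n"
    by (simp only: right_diff_distrib sum_subtractf[of _ _ ?P] flip: diff_divide_distrib sum_divide_distrib)
  also have "\<dots> = (\<Sum>S\<in>?P. ?c S * (\<Sum>Y\<in>?N. walsh S X - walsh S Y)) / 2 ^ n"
    by (subst sum.swap) (simp add: sum_distrib_left)
  also have "\<dots> = (\<Sum>S\<in>?P. (walsh S s - walsh S t) * walsh S X) / 2 ^ n"
    using ev X assms by (intro arg_cong2[where f = "(/)"] sum.cong refl)
      (auto simp: laplacian_walsh)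
  \<comment> \<open>The empty set rejoins with coefficient 1 - 1 = 0, so that orthogonality over all
    \<open>S\<close> applies.\<close>
  also have "\<dots> = (\<Sum>S\<in>Pow {..<n}. (walsh S s - walsh S t) * walsh S X) / 2 ^ n"
    by (simp add: sum_diff1)
  also have "\<dots> = ((\<Sum>S\<in>Pow {..<n}. walsh S s * walsh S X) -
      (\<Sum>S\<in>Pow {..<n}. walsh S t * walsh S X)) / 2 ^ n"
    by (simp add: left_diff_distrib sum_subtractf)
  also have "\<dots> = of_bool (X = s) - of_bool (X = t)"
    using X assms by (simp add: walsh_orthogonal diff_divide_distrib
        eq_commute[of s X] eq_commute[of t X])
  finally show "(\<Sum>Y\<in>?N. (\<Sum>S\<in>?P. ?c S * walsh S X) / 2 ^ n - (\<Sum>S\<in>?P. ?c S * walsh S Y) / 2 ^ n)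
      = of_bool (X = s) - of_bool (X = t)" .
qed

text \<open>The drop supplies a second factor \<open>walsh S s - walsh S t\<close>, and the square
  simplifies because squares of characters are 1.\<close>

lemma resistance_distance_enhanced_hypercube:
  assumes "1 \<le> k" "k < n" "length s = n" "length t = n"
  shows "resistance_distance (enhanced_hypercube n k) s t =
    (\<Sum>S\<in>Pow {..<n} - {{}}. (2 - 2 * (walsh S s * walsh S t)) / laplacian_eigenvalue n k S) / 2 ^ n"
proof -
  have square: "(walsh S s - walsh S t) * (walsh S s - walsh S t) = 2 - 2 * (walsh S s * walsh S t)"
    for S
    using walsh_square[of S s] walsh_square[of S t] by (simp add: algebra_simps)
  have "pair_graph (enhanced_hypercube n k)"
    using assms by (simp add: pair_graph_enhanced_hypercube)
  moreover have "s \<in> pverts (enhanced_hypercube n k)" "t \<in> pverts (enhanced_hypercube n k)"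
    using assms by (simp_all add: enhanced_hypercube_def)
  ultimately have "resistance_distance (enhanced_hypercube n k) s t =
    (\<Sum>S\<in>Pow {..<n} - {{}}. (walsh S s - walsh S t) / laplacian_eigenvalue n k S * walsh S s) / 2 ^ n -
    (\<Sum>S\<in>Pow {..<n} - {{}}. (walsh S s - walsh S t) / laplacian_eigenvalue n k S * walsh S t) / 2 ^ n"
    by (rule resistance_distance_eqI[OF _ _ _ unit_current_potential_walsh[OF assms]])
  also have "\<dots> = (\<Sum>S\<in>Pow {..<n} - {{}}.
      (walsh S s - walsh S t) * (walsh S s - walsh S t) / laplacian_eigenvalue n k S) / 2 ^ n"
    by (simp flip: right_diff_distrib sum_subtractf diff_divide_distrib)
  finally show ?thesis
    by (simp only: square)
qed

lemma kirchhoff_index_enhanced_hypercube: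
  assumes "1 \<le> k" "k < n"
  shows "kirchhoff_index (enhanced_hypercube n k) =
    2 ^ n * (\<Sum>S\<in>Pow {..<n} - {{}}. 1 / laplacian_eigenvalue n k S)"
proof -
  let ?V = "{X :: bool list. length X = n}"
  let ?P = "Pow {..<n} - {{}}"
  let ?ev = "laplacian_eigenvalue n k"
  let ?r = "\<lambda>s t. (\<Sum>S\<in>?P. (2 - 2 * (walsh S s * walsh S t)) / ?ev S) / 2 ^ n"
  have fin: "finite ?V" and card: "card ?V = 2 ^ n"
    using finite_lists_length_eq[of "UNIV :: bool set" n] card_lists_length_eq[of "UNIV :: bool set" n]
    by simp_all
  have V: "pverts (enhanced_hypercube n k) = ?V"
    by (simp add: enhanced_hypercube_def)
  have "kirchhoff_index (enhanced_hypercube n k) = (\<Sum>(s, t) | s \<in> ?V \<and> t \<in> ?V \<and> s < t. ?r s t)"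
    unfolding kirchhoff_index_def V using assms
    by (intro sum.cong) (auto simp: resistance_distance_enhanced_hypercube)
  also have "\<dots> = (\<Sum>s\<in>?V. \<Sum>t\<in>?V. ?r s t) / 2"
    by (rule sum_less_pairs[OF fin]) (simp_all add: mult.commute walsh_square)
  also have "(\<Sum>s\<in>?V. \<Sum>t\<in>?V. ?r s t) =
      (\<Sum>S\<in>?P. \<Sum>s\<in>?V. \<Sum>t\<in>?V. (2 - 2 * (walsh S s * walsh S t)) / ?ev S) / 2 ^ n"
    by (simp only: sum.swap[of _ ?P] flip: sum_divide_distrib)
  also have "(\<Sum>S\<in>?P. \<Sum>s\<in>?V. \<Sum>t\<in>?V. (2 - 2 * (walsh S s * walsh S t)) / ?ev S) =
      (\<Sum>S\<in>?P. 2 * (2 ^ n * 2 ^ n) / ?ev S)"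
  proof (rule sum.cong[OF refl])
    fix S assume S: "S \<in> ?P"
    \<comment> \<open>The cross terms factor into two full character sums, each 0 for nonempty
      \<open>S\<close>; the constant 2 over all ordered pairs remains.\<close>
    have "(\<Sum>s\<in>?V. \<Sum>t\<in>?V. 2 - 2 * (walsh S s * walsh S t)) =
        2 * (2 ^ n * 2 ^ n) - 2 * ((\<Sum>s\<in>?V. walsh S s) * (\<Sum>t\<in>?V. walsh S t))"
      by (simp add: sum_subtractf sum_product card flip: sum_distrib_left)
    then show "(\<Sum>s\<in>?V. \<Sum>t\<in>?V. (2 - 2 * (walsh S s * walsh S t)) / ?ev S) =
        2 * (2 ^ n * 2 ^ n) / ?ev S"
      using S sum_walsh[of S n] by (simp flip: sum_divide_distrib)
  qed
  finally show ?thesis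
    by (simp add: sum_distrib_left sum_divide_distrib)
qed

section \<open>Binomial estimates\<close>

lemma sum_Pow_card:
  fixes f :: "nat \<Rightarrow> real"
  shows "(\<Sum>S\<in>Pow {..<n}. f (card S)) = (\<Sum>j\<le>n. real (n choose j) * f j)"
proof -
  have "card ` Pow {..<n} \<subseteq> {..n}"
    using card_mono[of "{..<n}"] by fastforce
  then have "(\<Sum>S\<in>Pow {..<n}. f (card S)) =
      (\<Sum>j\<le>n. \<Sum>S | S \<in> Pow {..<n} \<and> card S = j. f (card S))"
    by (intro sum.group[symmetric]) auto
  also have "\<dots> = (\<Sum>j\<le>n. \<Sum>S | S \<subseteq> {..<n} \<and> card S = j. f j)"
    by (intro sum.cong) auto
  finally show ?thesis
    by (simp add: n_subsets)
qed

text \<open>Absorption: a denominator depending on \<open>j\<close> is traded for one that leaves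
  the sum over \<open>j\<close>.\<close>

lemma choose_div_Suc:
  "real (n choose j) / (real j + 1) = real (Suc n choose Suc j) / (real n + 1)"
proof -
  have "real (Suc n) * real (n choose j) = real (Suc n choose Suc j) * real (Suc j)"
    using Suc_times_binomial_eq[of n j] by (metis of_nat_mult)
  then show ?thesis
    by (simp add: field_simps)
qed

text \<open>Row \<open>n + 1\<close> of Pascal's triangle without its initial entry 1.\<close>

lemma sum_choose_Suc: "(\<Sum>j\<le>n. real (Suc n choose Suc j)) = 2 ^ Suc n - 1"
proof -
  have "(\<Sum>j\<le>Suc n. real (Suc n choose j)) = 2 ^ Suc n"
    using choose_row_sum[of "Suc n"] by (metis of_nat_sum of_nat_numeral of_nat_power)
  then show ?thesis
    by (subst (asm) sum.atMost_Suc_shift) simp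
qed

lemma sum_choose_div_Suc:
  "(\<Sum>j\<le>n. real (n choose j) * (1 / (real j + 1))) = (2 ^ Suc n - 1) / (real n + 1)"
  by (simp only: choose_div_Suc sum_choose_Suc times_divide_eq_right mult_1_right
      flip: sum_divide_distrib)

lemma sum_choose_div_Suc_Suc_le:
  "(\<Sum>j\<le>n. real (n choose j) * (1 / ((real j + 1) * (real j + 2))))
     \<le> 2 ^ (n + 2) / ((real n + 1) * (real n + 2))"
proof -
  have "real (n choose j) * (1 / ((real j + 1) * (real j + 2))) =
      real (Suc (Suc n) choose Suc (Suc j)) / ((real n + 1) * (real n + 2))" for j
  proof -
    have "real (n choose j) * (1 / ((real j + 1) * (real j + 2))) =
        real (n choose j) / (real j + 1) / (real j + 2)"
      by simp
    also have "\<dots> = real (Suc n choose Suc j) / (real (Suc j) + 1) / (real n + 1)"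
      unfolding choose_div_Suc[of n j] by (simp add: add.commute del: binomial_Suc_Suc)
    also have "\<dots> = real (Suc (Suc n) choose Suc (Suc j)) / ((real n + 1) * (real n + 2))"
      unfolding choose_div_Suc[of "Suc n" "Suc j"]
      by (simp add: add.commute mult.commute del: binomial_Suc_Suc)
    finally show ?thesis .
  qed
  then have "(\<Sum>j\<le>n. real (n choose j) * (1 / ((real j + 1) * (real j + 2)))) =
      (\<Sum>j\<le>n. real (Suc (Suc n) choose Suc (Suc j))) / ((real n + 1) * (real n + 2))"
    by (simp only: sum_divide_distrib)
  \<comment> \<open>Absorbing twice leaves row \<open>n + 2\<close> from index 2 on. Restoring the
    nonnegative entry at index 1 gives a known sum.\<close>
  also have "(\<Sum>j\<le>n. real (Suc (Suc n) choose Suc (Suc j))) \<le>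
      (\<Sum>j\<le>Suc n. real (Suc (Suc n) choose Suc j))"
    by (subst sum.atMost_Suc_shift) simp
  also have "\<dots> \<le> 2 ^ (n + 2)"
    by (simp only: sum_choose_Suc) simp
  finally show ?thesis
    by (simp add: divide_right_mono)
qed

section \<open>Two-sided bounds on the sum of inverse eigenvalues\<close>

lemma sum_inverse_eigenvalue_ge:
  "((2 ^ Suc n - 1) / (real n + 1) - 1) / 2 \<le>
    (\<Sum>S\<in>Pow {..<n} - {{}}. 1 / laplacian_eigenvalue n k S)"
proof -
  \<comment> \<open>The subtracted 1 inside is the term \<open>1 / (0 + 1)\<close> of the empty
    set.\<close>
  have "((2 ^ Suc n - 1) / (real n + 1) - 1) / 2 =
      (\<Sum>S\<in>Pow {..<n} - {{}}. 1 / (real (card S) + 1)) / 2"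
    by (simp only: sum_choose_div_Suc[symmetric] sum_Pow_card[symmetric])
      (simp add: sum_diff1)
  also have "\<dots> = (\<Sum>S\<in>Pow {..<n} - {{}}. 1 / (2 * (real (card S) + 1)))"
    by (simp add: sum_divide_distrib mult.commute)
  also have "\<dots> \<le> (\<Sum>S\<in>Pow {..<n} - {{}}. 1 / laplacian_eigenvalue n k S)"
  proof (rule sum_mono)
    fix S assume S: "S \<in> Pow {..<n} - {{}}"
    then have "card S > 0"
      by (auto simp: card_gt_0_iff intro: finite_subset)
    then have "0 < laplacian_eigenvalue n k S"
      using laplacian_eigenvalue_bounds(1)[of S n k] by linarith
    then show "1 / (2 * (real (card S) + 1)) \<le> 1 / laplacian_eigenvalue n k S"
      using laplacian_eigenvalue_bounds(2) by (intro divide_left_mono) auto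
  qed
  finally show ?thesis .
qed

lemma sum_inverse_eigenvalue_le:
  "(\<Sum>S\<in>Pow {..<n} - {{}}. 1 / laplacian_eigenvalue n k S) \<le>
    (2 ^ Suc n / (real n + 1) + 3 * (2 ^ (n + 2) / ((real n + 1) * (real n + 2)))) / 2"
proof -
  \<comment> \<open>Both terms of \<open>?g\<close> can be summed by absorption. For
    \<open>j \<ge> 1\<close> the difference \<open>1 / j - 1 / (j + 1) = 1 / (j * (j + 1))\<close>
    is at most \<open>3 / ((j + 1) * (j + 2))\<close>, since
    \<open>j + 2 \<le> 3 * j\<close>.\<close>
  let ?g = "\<lambda>j. (1 / (real j + 1) + 3 * (1 / ((real j + 1) * (real j + 2)))) / 2"
  have "(\<Sum>S\<in>Pow {..<n} - {{}}. 1 / laplacian_eigenvalue n k S) \<le>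
      (\<Sum>S\<in>Pow {..<n} - {{}}. ?g (card S))"
  proof (rule sum_mono)
    fix S assume S: "S \<in> Pow {..<n} - {{}}"
    then have c: "card S > 0"
      by (auto simp: card_gt_0_iff intro: finite_subset)
    then have "1 / laplacian_eigenvalue n k S \<le> 1 / (2 * real (card S))"
      using laplacian_eigenvalue_bounds(1)[of S n k] by (intro divide_left_mono) auto
    also have "\<dots> \<le> ?g (card S)"
      using c by (simp add: divide_simps) (simp add: algebra_simps)
    finally show "1 / laplacian_eigenvalue n k S \<le> ?g (card S)" .
  qed
  also have "\<dots> \<le> (\<Sum>S\<in>Pow {..<n}. ?g (card S))"
    by (intro sum_mono2) auto
  also have "\<dots> = ((\<Sum>j\<le>n. real (n choose j) * (1 / (real j + 1))) +
      3 * (\<Sum>j\<le>n. real (n choose j) * (1 / ((real j + 1) * (real j + 2))))) / 2"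
  proof -
    have "x * ((a + 3 * b) / 2) = (x * a + 3 * (x * b)) / 2" for x a b :: real
      by (simp add: algebra_simps)
    then show ?thesis
      unfolding sum_Pow_card[of ?g]
      by (simp only: sum.distrib flip: sum_divide_distrib sum_distrib_left)
  qed
  also have "\<dots> \<le> (2 ^ Suc n / (real n + 1) + 3 * (2 ^ (n + 2) / ((real n + 1) * (real n + 2)))) / 2"
    unfolding sum_choose_div_Suc using sum_choose_div_Suc_Suc_le[of n]
    by (intro divide_right_mono add_mono mult_left_mono) auto
  finally show ?thesis .
qed

section \<open>Squeezing the normalised Kirchhoff index\<close>

theorem theorem7:
  fixes k :: "nat \<Rightarrow> nat"
  assumes "\<And>n. n \<ge> 2 \<Longrightarrow> 1 \<le> k n \<and> k n \<le> n - 1"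
  shows "(\<lambda>n. kirchhoff_index (enhanced_hypercube n (k n)) / (2 ^ (2 * n) / (real n + 1)))
           \<longlonglongrightarrow> 1"
proof (rule tendsto_sandwich)
  let ?K = "\<lambda>n. kirchhoff_index (enhanced_hypercube n (k n)) / (2 ^ (2 * n) / (real n + 1))"
  let ?E = "\<lambda>n. \<Sum>S\<in>Pow {..<n} - {{}}. 1 / laplacian_eigenvalue n (k n) S"
  have K: "?K n = ?E n * ((real n + 1) / 2 ^ n)" if "n \<ge> 2" for n
  proof -
    have "1 \<le> k n" "k n < n"
      using assms[OF that] that by auto
    then show ?thesis
      by (simp add: kirchhoff_index_enhanced_hypercube power_add mult_2)
  qed
  show "\<forall>\<^sub>F n in sequentially. 1 - (real n + 2) / 2 ^ (n + 1) \<le> ?K n"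
    using eventually_ge_at_top[of 2]
  proof eventually_elim
    case (elim n)
    \<comment> \<open>The loss \<open>n + 2\<close> over \<open>2 ^ (n + 1)\<close> collects 1 from
      the omitted binomial entry and \<open>n + 1\<close> from the empty set.\<close>
    have "1 - (real n + 2) / 2 ^ (n + 1) =
        ((2 ^ Suc n - 1) / (real n + 1) - 1) / 2 * ((real n + 1) / 2 ^ n)"
      by (simp add: divide_simps) (simp add: algebra_simps)
    also have "\<dots> \<le> ?E n * ((real n + 1) / 2 ^ n)"
      by (intro mult_right_mono sum_inverse_eigenvalue_ge) simp
    finally show ?case
      using K[OF elim] by simp
  qed
  show "\<forall>\<^sub>F n in sequentially. ?K n \<le> 1 + 6 / (real n + 2)"
    using eventually_ge_at_top[of 2]
  proof eventually_elim
    case (elim n)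
    have "?E n * ((real n + 1) / 2 ^ n) \<le>
        (2 ^ Suc n / (real n + 1) + 3 * (2 ^ (n + 2) / ((real n + 1) * (real n + 2)))) / 2 *
        ((real n + 1) / 2 ^ n)"
      by (intro mult_right_mono sum_inverse_eigenvalue_le) simp
    \<comment> \<open>The 6 is the factor 3 of the comparison times
      \<open>2 ^ (n + 2) / 2 ^ n = 4\<close>, halved.\<close>
    also have "\<dots> = 1 + 6 / (real n + 2)"
      by (simp add: divide_simps) (simp add: algebra_simps)
    finally show ?case
      using K[OF elim] by simp
  qed
  show "(\<lambda>n. 1 - (real n + 2) / 2 ^ (n + 1)) \<longlonglongrightarrow> 1"
    by real_asymp
  show "(\<lambda>n. 1 + 6 / (real n + 2)) \<longlonglongrightarrow> 1"
    by real_asymp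
qed

end
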